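(* (d'Ocagne's identity.) For all integers $n, m \ge 0$, \[ Q^P_m\,Q^P_{n+1} - Q^P_{m+1}\,Q^P_n = (-1)^n\, 2\,P_{m-n}\,(1 + i + 6\varepsilon + 6\,i\varepsilon). \]
   Context: Dual-complex numbers are expressions $x_1 + i\,x_2 + \varepsilon\,y_1 + i\varepsilon\,y_2$ with real coefficients, forming a commutative associative real algebra with basis $\{1,i,\varepsilon,i\varepsilon\}$, where $i^2=-1$, $\varepsilon\ne 0$, $\varepsilon^2=0$, $i\varepsilon=\varepsilon i$, $(i\varepsilon)^2=0$. Pell numbers: $P_0=0$, $P_1=1$, $P_n=2P_{n-1}+P_{n-2}$, extended to negative indices by the same recurrence, i.e. $P_{-k}=(-1)^{k+1}P_k$. The dual-complex Pell quaternion is $Q^P_n = P_n + i\,P_{n+1} + \varepsilon\,P_{n+2} + i\varepsilon\,P_{n+3}$, with products taken in the dual-complex algebra. *)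

theory Defs
  imports Complex_Main
begin

codatatype dual_complex =
  Dual_Complex (re_part: real) (i_part: real) (eps_part: real) (ieps_part: real)

lemma dual_complex_eqI:
  "\<lbrakk>re_part x = re_part y; i_part x = i_part y; eps_part x = eps_part y; ieps_part x = ieps_part y\<rbrakk>
    \<Longrightarrow> x = y"
  by (rule dual_complex.expand) simp

lemma dual_complex_eq_iff:
  "x = y \<longleftrightarrow> re_part x = re_part y \<and> i_part x = i_part y \<and>
     eps_part x = eps_part y \<and> ieps_part x = ieps_part y"
  by (auto intro: dual_complex_eqI)

text \<open>
  The product extends bilinearly the multiplication of the basis
  \<open>1, i, \<epsilon>, i\<epsilon>\<close> determined by \<open>i\<^sup>2 = -1\<close>,
  \<open>\<epsilon>\<^sup>2 = 0\<close> and \<open>i\<epsilon> = \<epsilon>i\<close>.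
\<close>

instantiation dual_complex :: "{comm_ring_1, real_algebra_1}"
begin

primcorec zero_dual_complex where
  "re_part 0 = 0"
| "i_part 0 = 0"
| "eps_part 0 = 0"
| "ieps_part 0 = 0"

primcorec one_dual_complex where
  "re_part 1 = 1"
| "i_part 1 = 0"
| "eps_part 1 = 0"
| "ieps_part 1 = 0"

primcorec plus_dual_complex where
  "re_part (x + y) = re_part x + re_part y"
| "i_part (x + y) = i_part x + i_part y"
| "eps_part (x + y) = eps_part x + eps_part y"
| "ieps_part (x + y) = ieps_part x + ieps_part y"

primcorec uminus_dual_complex where
  "re_part (- x) = - re_part x"
| "i_part (- x) = - i_part x"
| "eps_part (- x) = - eps_part x"
| "ieps_part (- x) = - ieps_part x"

primcorec minus_dual_complex where
  "re_part (x - y) = re_part x - re_part y"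
| "i_part (x - y) = i_part x - i_part y"
| "eps_part (x - y) = eps_part x - eps_part y"
| "ieps_part (x - y) = ieps_part x - ieps_part y"

primcorec times_dual_complex where
  "re_part (x * y) = re_part x * re_part y - i_part x * i_part y"
| "i_part (x * y) = re_part x * i_part y + i_part x * re_part y"
| "eps_part (x * y) = re_part x * eps_part y + eps_part x * re_part y
     - i_part x * ieps_part y - ieps_part x * i_part y"
| "ieps_part (x * y) = re_part x * ieps_part y + ieps_part x * re_part y
     + i_part x * eps_part y + eps_part x * i_part y"

primcorec scaleR_dual_complex where
  "re_part (scaleR r x) = r * re_part x"
| "i_part (scaleR r x) = r * i_part x"
| "eps_part (scaleR r x) = r * eps_part x"
| "ieps_part (scaleR r x) = r * ieps_part x"

instance
  by standard (simp_all add: dual_complex_eq_iff algebra_simps)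

end

definition dc_i :: dual_complex where
  "dc_i = Dual_Complex 0 1 0 0"

definition dc_eps :: dual_complex where
  "dc_eps = Dual_Complex 0 0 1 0"

lemma dc_i_sel [simp]:
  "re_part dc_i = 0" "i_part dc_i = 1" "eps_part dc_i = 0" "ieps_part dc_i = 0"
  by (simp_all add: dc_i_def)

lemma dc_eps_sel [simp]:
  "re_part dc_eps = 0" "i_part dc_eps = 0" "eps_part dc_eps = 1" "ieps_part dc_eps = 0"
  by (simp_all add: dc_eps_def)

lemma dual_complex_relations:
  "dc_i ^ 2 = -1"
  "dc_eps \<noteq> 0"
  "dc_eps ^ 2 = 0"
  "dc_i * dc_eps = dc_eps * dc_i"
  "(dc_i * dc_eps) ^ 2 = 0"
  by (simp_all add: dual_complex_eq_iff power2_eq_square)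

lemma dual_complex_basis:
  "x = a *\<^sub>R 1 + b *\<^sub>R dc_i + c *\<^sub>R dc_eps + d *\<^sub>R (dc_i * dc_eps) \<longleftrightarrow>
     a = re_part x \<and> b = i_part x \<and> c = eps_part x \<and> d = ieps_part x"
  by (auto simp: dual_complex_eq_iff)

fun pell_nat :: "nat \<Rightarrow> int" where
  "pell_nat 0 = 0"
| "pell_nat (Suc 0) = 1"
| "pell_nat (Suc (Suc n)) = 2 * pell_nat (Suc n) + pell_nat n"

definition pell :: "int \<Rightarrow> int" where
  "pell k = (if k \<ge> 0 then pell_nat (nat k)
             else (-1) ^ (nat (- k) + 1) * pell_nat (nat (- k)))"

lemma pell_0 [simp]: "pell 0 = 0"
  and pell_1 [simp]: "pell 1 = 1"
  by (simp_all add: pell_def)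

lemma pell_uminus_of_nat: "pell (- int k) = (-1) ^ (k + 1) * pell (int k)"
  by (cases "k = 0") (simp_all add: pell_def)

lemma pell_recurrence: "pell k = 2 * pell (k - 1) + pell (k - 2)"
proof -
  consider n where "k = int n + 2" | "k = 1" | n where "k = - int n"
  proof (cases "k \<ge> 2")
    case True
    then show ?thesis using that(1)[of "nat (k - 2)"] by simp
  next
    case False
    then show ?thesis using that(2) that(3)[of "nat (- k)"] by fastforce
  qed
  then show ?thesis
  proof cases
    case (1 n)
    have "nat (int n + 2) = Suc (Suc n)" "nat (1 + int n) = Suc n" by simp_all
    then show ?thesis using 1 by (simp add: pell_def)
  next
    case 2
    then show ?thesis using pell_uminus_of_nat[of 1] by simp
  next
    case (3 n)
    have eqs: "k - 1 = - int (Suc n)" "k - 2 = - int (Suc (Suc n))" using 3 by simp_all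
    have nn: "pell (int j) = pell_nat j" for j by (simp add: pell_def)
    show ?thesis
      unfolding eqs unfolding 3 pell_uminus_of_nat nn by (simp add: algebra_simps)
  qed
qed

definition pell_quaternion :: "int \<Rightarrow> dual_complex" where
  "pell_quaternion n =
     of_int (pell n) + dc_i * of_int (pell (n + 1))
     + dc_eps * of_int (pell (n + 2)) + dc_i * dc_eps * of_int (pell (n + 3))"

end

(* The left-hand side is bilinear in (P_m, P_{m+1}) and (P_n, P_{n+1}), and each of its components is
   a multiple of the determinant P_m P_{n+1} - P_{m+1} P_n.  The recurrence flips the sign of this
   determinant when both indices are shifted by one, so it equals (-1)^n P_{m-n}. *)
theory Submission
  imports Defs
begin

text \<open>An embedded integer is a real multiple of \<open>1\<close>, and \<open>scaleR\<close>
  acts componentwise.\<close>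

lemma dual_complex_of_int_sel [simp]:
  "re_part (of_int k) = of_int k" "i_part (of_int k) = 0"
  "eps_part (of_int k) = 0" "ieps_part (of_int k) = 0"
proof -
  have "of_int k = (of_int k :: real) *\<^sub>R (1 :: dual_complex)"
    by (simp add: scaleR_conv_of_real)
  then show "re_part (of_int k) = of_int k" "i_part (of_int k) = 0"
    "eps_part (of_int k) = 0" "ieps_part (of_int k) = 0"
    by simp_all
qed

lemma dual_complex_numeral_sel [simp]:
  "re_part (numeral w) = numeral w" "i_part (numeral w) = 0"
  "eps_part (numeral w) = 0" "ieps_part (numeral w) = 0"
  using dual_complex_of_int_sel[of "numeral w"] by simp_all

text \<open>This and the next two lemmas reduce all shifts to the basis \<open>pell k\<close>,
  \<open>pell (k + 1)\<close>; shift 4 comes from the last component at index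
  \<open>k + 1\<close>.\<close>

lemma pell_add_2: "pell (k + 2) = 2 * pell (k + 1) + pell k"
  using pell_recurrence[of "k + 2"] by (simp add: add.commute)

lemma pell_add_3: "pell (k + 3) = 5 * pell (k + 1) + 2 * pell k"
  using pell_add_2[of "k + 1"] pell_add_2[of k] by (simp add: add.commute)

lemma pell_add_4: "pell (k + 4) = 12 * pell (k + 1) + 5 * pell k"
  using pell_add_2[of "k + 2"] pell_add_2[of k] pell_add_3[of k] by (simp add: add.commute)

text \<open>Here \<open>k\<close> ranges over all integers because the induction lowers it together
  with \<open>n\<close>, possibly below zero.\<close>

lemma pell_dOcagne:
  "pell k * pell (int n + 1) - pell (k + 1) * pell (int n) = (-1) ^ n * pell (k - int n)"
proof (induction n arbitrary: k)
  case 0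
  show ?case by simp
next
  case (Suc n)
  have "pell (k + 1) = 2 * pell k + pell (k - 1)"
    using pell_add_2[of "k - 1"] by (simp add: add.commute)
  moreover have "pell (int (Suc n) + 1) = 2 * pell (int n + 1) + pell (int n)"
    using pell_add_2[of "int n"] by (simp add: add.commute)
  ultimately show ?case
    \<comment> \<open>Passing to \<open>k - 1\<close> and \<open>n\<close> keeps the index
      difference \<open>k - int (Suc n)\<close>.\<close>
    using Suc.IH[of "k - 1"] by (simp add: algebra_simps)
qed

theorem theorem3p3:
  fixes m n :: nat
  shows "pell_quaternion (int m) * pell_quaternion (int n + 1)
           - pell_quaternion (int m + 1) * pell_quaternion (int n)
         = (-1) ^ n * 2 * of_int (pell (int m - int n))
             * (1 + dc_i + 6 * dc_eps + 6 * (dc_i * dc_eps))"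
proof -
  define d where "d = pell (int m) * pell (int n + 1) - pell (int m + 1) * pell (int n)"
  have "(-1) ^ n * 2 * of_int (pell (int m - int n)) = (of_int (2 * d) :: dual_complex)"
    unfolding d_def pell_dOcagne by (simp add: mult.assoc mult.left_commute)
  moreover have "pell_quaternion (int m) * pell_quaternion (int n + 1)
           - pell_quaternion (int m + 1) * pell_quaternion (int n)
         = of_int (2 * d) * (1 + dc_i + 6 * dc_eps + 6 * (dc_i * dc_eps))"
    unfolding dual_complex_eq_iff d_def pell_quaternion_def
    \<comment> \<open>Keeping \<open>of_int\<close> undistributed lets the selectors act on whole
      integers; the expansion then happens in the reals.\<close>
    by (simp add: pell_add_2 pell_add_3 pell_add_4 add.assoc del: of_int_mult of_int_add of_int_diff)
       (simp add: algebra_simps)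
  ultimately show ?thesis by simp
qed

end
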